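(* Let $C$ be a connected symmetric configuration $v_3$. For $1\le i\le 5$ let $b_i$ be the number of occurrences in $C$ of the three-block fragment $B_i$, and let $t=b_5$ be the number of triangles in $C$. Then $$b_1=\frac{v^3-21v^2+122v-6t}{6},\qquad b_2=3\bigl(v(v-11)+t\bigr),\qquad b_3=v,\qquad b_4=3(4v-t),\qquad b_5=t.$$
   Context: A symmetric configuration $v_3$ is a finite incidence structure with $v$ points and $v$ blocks such that each block contains exactly $3$ points, each point is contained in exactly $3$ blocks, and any pair of distinct points is contained in at most one block. It is connected (indecomposable) if it is not the union of two configurations on disjoint point sets. The five three-block fragments are the following isomorphism types of sets of three distinct blocks, where different letters denote different points and $xyz$ denotes the block $\{x,y,z\}$: - $B_1$ (3-partial parallel class): $abc, def, ghi$; - $B_2$ (hut): $abc, def, dgh$; - $B_3$ (3-star): $abc, ade, afg$; - $B_4$ (3-path): $abc, cde, efg$; - $B_5$ (triangle): $abf, ace, bcd$. The number of occurrences of $B_i$ in a configuration is the number of (unordered) sets of three distinct blocks of the configuration that are isomorphic to $B_i$. *)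

theory Defs
  imports Complex_Main
begin

text \<open>
  Blocks are represented by the sets of points they contain.  This loses nothing: two blocks
  with the same three points would violate the condition on pairs of points.
\<close>

definition symmetric_configuration :: "nat \<Rightarrow> 'a set \<Rightarrow> 'a set set \<Rightarrow> bool" where
  "symmetric_configuration v P B \<longleftrightarrow>
     finite P \<and> card P = v \<and> B \<subseteq> Pow P \<and> card B = v \<and>
     (\<forall>b\<in>B. card b = 3) \<and>
     (\<forall>x\<in>P. card {b\<in>B. x \<in> b} = 3) \<and>
     (\<forall>x\<in>P. \<forall>y\<in>P. x \<noteq> y \<longrightarrow> card {b\<in>B. x \<in> b \<and> y \<in> b} \<le> 1)"

text \<open>
  The two parts are required to be nonempty, since otherwise every configuration would be
  decomposable into itself and the empty one.
\<close>

definition connected_configuration :: "'a set \<Rightarrow> 'a set set \<Rightarrow> bool" where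
  "connected_configuration P B \<longleftrightarrow>
     \<not> (\<exists>v\<^sub>1 P\<^sub>1 B\<^sub>1 v\<^sub>2 P\<^sub>2 B\<^sub>2.
          symmetric_configuration v\<^sub>1 P\<^sub>1 B\<^sub>1 \<and> symmetric_configuration v\<^sub>2 P\<^sub>2 B\<^sub>2 \<and>
          P\<^sub>1 \<noteq> {} \<and> P\<^sub>2 \<noteq> {} \<and> P\<^sub>1 \<inter> P\<^sub>2 = {} \<and>
          P = P\<^sub>1 \<union> P\<^sub>2 \<and> B = B\<^sub>1 \<union> B\<^sub>2)"

definition isomorphic_blocks :: "'a set set \<Rightarrow> 'b set set \<Rightarrow> bool" where
  "isomorphic_blocks S T \<longleftrightarrow> (\<exists>f. bij_betw f (\<Union>S) (\<Union>T) \<and> (\<lambda>b. f ` b) ` S = T)"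

text \<open>The points of the model fragments are characters, so \<open>set ''abc''\<close> is the block \<open>{a, b, c}\<close>.\<close>

definition partial_parallel_class_fragment :: "char set set" where
  "partial_parallel_class_fragment = {set ''abc'', set ''def'', set ''ghi''}"

definition hut_fragment :: "char set set" where
  "hut_fragment = {set ''abc'', set ''def'', set ''dgh''}"

definition star_fragment :: "char set set" where
  "star_fragment = {set ''abc'', set ''ade'', set ''afg''}"

definition path_fragment :: "char set set" where
  "path_fragment = {set ''abc'', set ''cde'', set ''efg''}"

definition triangle_fragment :: "char set set" where
  "triangle_fragment = {set ''abf'', set ''ace'', set ''bcd''}"

definition occurrences :: "char set set \<Rightarrow> 'a set set \<Rightarrow> nat" where
  "occurrences F B = card {S. S \<subseteq> B \<and> card S = 3 \<and> isomorphic_blocks F S}"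

end

theory Submission imports Defs begin

text \<open>
  Two blocks meet in at most one point, so the graph of intersecting blocks is 6-regular on
  \<open>v\<close> vertices.  A set of three blocks spans 0, 1, 2 or 3 edges of it; the fragments
  \<open>B\<^sub>1\<close>, \<open>B\<^sub>2\<close>, \<open>B\<^sub>4\<close> are the cases 0, 1, 2, while 3 edges give \<open>B\<^sub>3\<close> or \<open>B\<^sub>5\<close>.
  Counting ordered triples of blocks, those whose first two blocks meet, and those whose first
  block meets both others gives three linear equations; stars correspond to points, which
  gives \<open>b\<^sub>3 = v\<close>.
\<close>

section \<open>Three-block fragments\<close>

definition orderings :: "'b set \<Rightarrow> ('b \<times> 'b \<times> 'b) set" where
  "orderings S = {(X, Y, Z). X \<noteq> Y \<and> X \<noteq> Z \<and> Y \<noteq> Z \<and> S = {X, Y, Z}}"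

text \<open>Twice the number of edges that a 3-set \<open>S\<close> spans in the intersection graph:
  an edge has two orders, and the third block is then determined.\<close>

definition meet_count :: "'a set set \<Rightarrow> nat" where
  "meet_count S = (\<Sum>(X, Y, Z) \<in> orderings S. of_bool (X \<inter> Y \<noteq> {}))"

text \<open>Twice the number of pairs of edges sharing a block: \<open>X\<close> is the centre and
  its two ends may be swapped. For 3-sets with 0, 1, 2, 3 edges this gives 0, 0, 2, 6.\<close>

definition cherry_count :: "'a set set \<Rightarrow> nat" where
  "cherry_count S = (\<Sum>(X, Y, Z) \<in> orderings S. of_bool (X \<inter> Y \<noteq> {} \<and> X \<inter> Z \<noteq> {}))"

lemma orderings_eq:
  assumes "X \<noteq> Y" "X \<noteq> Z" "Y \<noteq> Z"
  shows "orderings {X, Y, Z} =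
    {(X, Y, Z), (X, Z, Y), (Y, X, Z), (Y, Z, X), (Z, X, Y), (Z, Y, X)}"
proof (rule subset_antisym)
  show "orderings {X, Y, Z} \<subseteq>
    {(X, Y, Z), (X, Z, Y), (Y, X, Z), (Y, Z, X), (Z, X, Y), (Z, Y, X)}"
  proof
    fix t assume "t \<in> orderings {X, Y, Z}"
    moreover obtain U V W where t: "t = (U, V, W)" by (cases t) auto
    ultimately have eq: "{X, Y, Z} = {U, V, W}" and neq: "U \<noteq> V" "U \<noteq> W" "V \<noteq> W"
      by (simp_all add: orderings_def)
    have "U \<in> {X, Y, Z}" "V \<in> {X, Y, Z}" "W \<in> {X, Y, Z}" by (simp_all only: eq insert_iff simp_thms)
    then show "t \<in> {(X, Y, Z), (X, Z, Y), (Y, X, Z), (Y, Z, X), (Z, X, Y), (Z, Y, X)}"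
      using neq unfolding t by auto
  qed
qed (use assms in \<open>auto simp: orderings_def\<close>)

lemma card_orderings:
  assumes "card S = 3"
  shows "card (orderings S) = 6"
proof -
  obtain X Y Z where "S = {X, Y, Z}" "X \<noteq> Y" "X \<noteq> Z" "Y \<noteq> Z"
    using assms by (auto simp: card_3_iff)
  then show ?thesis by (simp add: orderings_eq)
qed

lemma meet_count_eq:
  assumes "X \<noteq> Y" "X \<noteq> Z" "Y \<noteq> Z"
  shows "meet_count {X, Y, Z} =
    2 * (of_bool (X \<inter> Y \<noteq> {}) + of_bool (X \<inter> Z \<noteq> {}) + of_bool (Y \<inter> Z \<noteq> {}))"
  using assms by (simp add: meet_count_def orderings_eq Int_commute)

lemma cherry_count_eq:
  assumes "X \<noteq> Y" "X \<noteq> Z" "Y \<noteq> Z"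
  shows "cherry_count {X, Y, Z} =
    2 * (of_bool (X \<inter> Y \<noteq> {} \<and> X \<inter> Z \<noteq> {}) + of_bool (X \<inter> Y \<noteq> {} \<and> Y \<inter> Z \<noteq> {})
      + of_bool (X \<inter> Z \<noteq> {} \<and> Y \<inter> Z \<noteq> {}))"
  using assms by (simp add: cherry_count_def orderings_eq Int_commute conj_commute)

section \<open>Isomorphism invariants of the fragments\<close>

text \<open>An injective point map commutes with intersections, so the images of \<open>F\<close>,
  \<open>G\<close>, \<open>H\<close> keep the whole pattern of empty and nonempty
  intersections.\<close>

lemma isomorphic_blocks_triple:
  assumes "isomorphic_blocks {F, G, H} S" and "F \<noteq> G" "F \<noteq> H" "G \<noteq> H"
  obtains X Y Z where "S = {X, Y, Z}" "X \<noteq> Y" "X \<noteq> Z" "Y \<noteq> Z"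
    "X \<inter> Y = {} \<longleftrightarrow> F \<inter> G = {}" "X \<inter> Z = {} \<longleftrightarrow> F \<inter> H = {}" "Y \<inter> Z = {} \<longleftrightarrow> G \<inter> H = {}"
    "X \<inter> Y \<inter> Z = {} \<longleftrightarrow> F \<inter> G \<inter> H = {}"
proof -
  obtain f where f: "bij_betw f (\<Union>{F, G, H}) (\<Union>S)" and im: "(\<lambda>b. f ` b) ` {F, G, H} = S"
    using assms(1) unfolding isomorphic_blocks_def by blast
  have inj: "inj_on f (F \<union> G \<union> H)"
    using f by (simp add: bij_betw_def Un_assoc)
  have int: "f ` A \<inter> f ` C = f ` (A \<inter> C)" if "A \<subseteq> F \<union> G \<union> H" "C \<subseteq> F \<union> G \<union> H" for A C
    using inj_on_image_Int[OF inj that] by simp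
  have neq: "f ` A \<noteq> f ` C" if "A \<noteq> C" "A \<subseteq> F \<union> G \<union> H" "C \<subseteq> F \<union> G \<union> H" for A C
    using inj_on_image_eq_iff[OF inj that(2,3)] that(1) by simp
  have FG: "f ` F \<inter> f ` G = f ` (F \<inter> G)" and FH: "f ` F \<inter> f ` H = f ` (F \<inter> H)"
    and GH: "f ` G \<inter> f ` H = f ` (G \<inter> H)" by (rule int; blast)+
  have FGH: "f ` (F \<inter> G) \<inter> f ` H = f ` (F \<inter> G \<inter> H)" by (rule int; blast)
  show ?thesis
  proof (rule that[of "f ` F" "f ` G" "f ` H"])
    show "S = {f ` F, f ` G, f ` H}" using im by auto
    show "f ` F \<noteq> f ` G" by (rule neq[OF assms(2)]; blast)
    show "f ` F \<noteq> f ` H" by (rule neq[OF assms(3)]; blast)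
    show "f ` G \<noteq> f ` H" by (rule neq[OF assms(4)]; blast)
  qed (simp_all only: FG FH GH FGH image_is_empty)
qed

text \<open>This and the next four lemmas make the fragment types mutually exclusive:
  \<open>meet_count\<close> takes the values 0, 2, 6, 4, 6, and the two types of value 6 differ in
  having a common point.\<close>

lemma isomorphic_partial_parallel_classD:
  assumes "isomorphic_blocks partial_parallel_class_fragment S"
  shows "meet_count S = 0"
proof -
  have "set ''abc'' \<noteq> set ''def''" "set ''abc'' \<noteq> set ''ghi''" "set ''def'' \<noteq> set ''ghi''"
    by (simp_all add: set_eq_subset)
  from isomorphic_blocks_triple[OF assms[unfolded partial_parallel_class_fragment_def] this]
  show ?thesis by (rule; simp add: meet_count_eq)
qed

lemma isomorphic_hutD:
  assumes "isomorphic_blocks hut_fragment S"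
  shows "meet_count S = 2"
proof -
  have "set ''abc'' \<noteq> set ''def''" "set ''abc'' \<noteq> set ''dgh''" "set ''def'' \<noteq> set ''dgh''"
    by (simp_all add: set_eq_subset)
  from isomorphic_blocks_triple[OF assms[unfolded hut_fragment_def] this]
  show ?thesis by (rule; simp add: meet_count_eq)
qed

lemma isomorphic_starD:
  assumes "isomorphic_blocks star_fragment S"
  shows "meet_count S = 6 \<and> \<Inter>S \<noteq> {}"
proof -
  have "set ''abc'' \<noteq> set ''ade''" "set ''abc'' \<noteq> set ''afg''" "set ''ade'' \<noteq> set ''afg''"
    by (simp_all add: set_eq_subset)
  from isomorphic_blocks_triple[OF assms[unfolded star_fragment_def] this]
  show ?thesis by (rule; simp add: meet_count_eq Int_assoc)
qed

lemma isomorphic_pathD: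
  assumes "isomorphic_blocks path_fragment S"
  shows "meet_count S = 4"
proof -
  have "set ''abc'' \<noteq> set ''cde''" "set ''abc'' \<noteq> set ''efg''" "set ''cde'' \<noteq> set ''efg''"
    by (simp_all add: set_eq_subset)
  from isomorphic_blocks_triple[OF assms[unfolded path_fragment_def] this]
  show ?thesis by (rule; simp add: meet_count_eq)
qed

lemma isomorphic_triangleD:
  assumes "isomorphic_blocks triangle_fragment S"
  shows "meet_count S = 6 \<and> \<Inter>S = {}"
proof -
  have "set ''abf'' \<noteq> set ''ace''" "set ''abf'' \<noteq> set ''bcd''" "set ''ace'' \<noteq> set ''bcd''"
    by (simp_all add: set_eq_subset)
  from isomorphic_blocks_triple[OF assms[unfolded triangle_fragment_def] this]
  show ?thesis by (rule; simp add: meet_count_eq Int_assoc)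
qed

section \<open>Isomorphisms given by naming points with letters\<close>

text \<open>Distinctness of the mapped letter list gives injectivity on the letters, in a form that
  simplification can check; surjectivity onto the points of \<open>S\<close> comes for free from the
  image equation.\<close>

lemma isomorphic_blocksI:
  assumes "distinct (map f cs)" and "\<Union>F \<subseteq> set cs" and "(\<lambda>b. f ` b) ` F = S"
  shows "isomorphic_blocks F S"
proof -
  have "inj_on f (\<Union>F)" using assms(1,2) inj_on_subset by (auto simp: distinct_map)
  then show ?thesis
    unfolding isomorphic_blocks_def bij_betw_def using assms(3) by (intro exI[of _ f]) auto
qed

lemma isomorphic_partial_parallel_classI:
  assumes "distinct [a, b, c, d, e, f, g, h, i]"
  shows "isomorphic_blocks partial_parallel_class_fragment {{a, b, c}, {d, e, f}, {g, h, i}}"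
  unfolding partial_parallel_class_fragment_def
  \<comment> \<open>Each letter goes to the point of the same name. The default value of the
    function is the image of the last letter, which therefore needs no update.\<close>
  by (rule isomorphic_blocksI[where cs = "''abcdefghi''"
      and f = "(\<lambda>_. i)(CHR ''a'' := a, CHR ''b'' := b, CHR ''c'' := c,
    CHR ''d'' := d, CHR ''e'' := e, CHR ''f'' := f, CHR ''g'' := g, CHR ''h'' := h)"])
    (use assms in \<open>simp_all add: insert_commute\<close>)

lemma isomorphic_hutI:
  assumes "distinct [a, b, c, d, e, f, g, h]"
  shows "isomorphic_blocks hut_fragment {{a, b, c}, {d, e, f}, {d, g, h}}"
  unfolding hut_fragment_def
  by (rule isomorphic_blocksI[where cs = "''abcdefgh''"
      and f = "(\<lambda>_. h)(CHR ''a'' := a, CHR ''b'' := b, CHR ''c'' := c,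
    CHR ''d'' := d, CHR ''e'' := e, CHR ''f'' := f, CHR ''g'' := g)"])
    (use assms in \<open>simp_all add: insert_commute\<close>)

lemma isomorphic_starI:
  assumes "distinct [a, b, c, d, e, f, g]"
  shows "isomorphic_blocks star_fragment {{a, b, c}, {a, d, e}, {a, f, g}}"
  unfolding star_fragment_def
  by (rule isomorphic_blocksI[where cs = "''abcdefg''"
      and f = "(\<lambda>_. g)(CHR ''a'' := a, CHR ''b'' := b, CHR ''c'' := c,
    CHR ''d'' := d, CHR ''e'' := e, CHR ''f'' := f)"])
    (use assms in \<open>simp_all add: insert_commute\<close>)

lemma isomorphic_pathI:
  assumes "distinct [a, b, c, d, e, f, g]"
  shows "isomorphic_blocks path_fragment {{a, b, c}, {c, d, e}, {e, f, g}}"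
  unfolding path_fragment_def
  by (rule isomorphic_blocksI[where cs = "''abcdefg''"
      and f = "(\<lambda>_. g)(CHR ''a'' := a, CHR ''b'' := b, CHR ''c'' := c,
    CHR ''d'' := d, CHR ''e'' := e, CHR ''f'' := f)"])
    (use assms in \<open>simp_all add: insert_commute\<close>)

lemma isomorphic_triangleI:
  assumes "distinct [a, b, c, d, e, f]"
  shows "isomorphic_blocks triangle_fragment {{a, b, f}, {a, c, e}, {b, c, d}}"
  unfolding triangle_fragment_def
  by (rule isomorphic_blocksI[where cs = "''abcdef''"
      and f = "(\<lambda>_. f)(CHR ''a'' := a, CHR ''b'' := b, CHR ''c'' := c,
    CHR ''d'' := d, CHR ''e'' := e)"])
    (use assms in \<open>simp_all add: insert_commute\<close>)

section \<open>Fragment type from the intersection pattern\<close>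

lemma card_3_elem:
  assumes "card X = 3" "x \<in> X"
  obtains y z where "X = {x, y, z}" "x \<noteq> y" "x \<noteq> z" "y \<noteq> z"
  using assms by (auto simp: card_3_iff)

lemma card_3_elem2:
  assumes "card X = 3" "x \<in> X" "y \<in> X" "x \<noteq> y"
  obtains z where "X = {x, y, z}" "x \<noteq> z" "y \<noteq> z"
  using assms by (auto simp: card_3_iff)

text \<open>Blocks of size three that pairwise share at most one point are determined up to
  isomorphism by which intersections are empty: name the shared points first, then the rest. In the
  hut case \<open>X\<close> is the isolated block, in the path case \<open>Y\<close> is the middle
  one.\<close>

lemma linear_triple_fragment:
  assumes card: "card X = 3" "card Y = 3" "card Z = 3"
    and neq: "X \<noteq> Y" "X \<noteq> Z" "Y \<noteq> Z"
    and XY: "\<And>x y. x \<in> X \<inter> Y \<Longrightarrow> y \<in> X \<inter> Y \<Longrightarrow> x = y"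
    and XZ: "\<And>x y. x \<in> X \<inter> Z \<Longrightarrow> y \<in> X \<inter> Z \<Longrightarrow> x = y"
    and YZ: "\<And>x y. x \<in> Y \<inter> Z \<Longrightarrow> y \<in> Y \<inter> Z \<Longrightarrow> x = y"
  shows linear_triple_partial_parallel_class:
      "X \<inter> Y = {} \<Longrightarrow> X \<inter> Z = {} \<Longrightarrow> Y \<inter> Z = {} \<Longrightarrow>
        isomorphic_blocks partial_parallel_class_fragment {X, Y, Z}"
    and linear_triple_hut:
      "X \<inter> Y = {} \<Longrightarrow> X \<inter> Z = {} \<Longrightarrow> Y \<inter> Z \<noteq> {} \<Longrightarrow>
        isomorphic_blocks hut_fragment {X, Y, Z}"
    and linear_triple_star:
      "X \<inter> Y \<inter> Z \<noteq> {} \<Longrightarrow> isomorphic_blocks star_fragment {X, Y, Z}"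
    and linear_triple_path:
      "X \<inter> Y \<noteq> {} \<Longrightarrow> X \<inter> Z = {} \<Longrightarrow> Y \<inter> Z \<noteq> {} \<Longrightarrow>
        isomorphic_blocks path_fragment {X, Y, Z}"
    and linear_triple_triangle:
      "X \<inter> Y \<noteq> {} \<Longrightarrow> X \<inter> Z \<noteq> {} \<Longrightarrow> Y \<inter> Z \<noteq> {} \<Longrightarrow> X \<inter> Y \<inter> Z = {} \<Longrightarrow>
        isomorphic_blocks triangle_fragment {X, Y, Z}"
proof -
  show "isomorphic_blocks partial_parallel_class_fragment {X, Y, Z}"
    if disj: "X \<inter> Y = {}" "X \<inter> Z = {}" "Y \<inter> Z = {}"
  proof -
    obtain a b c where X: "X = {a, b, c}" "a \<noteq> b" "a \<noteq> c" "b \<noteq> c"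
      using card(1) by (auto simp: card_3_iff)
    obtain d e f where Y: "Y = {d, e, f}" "d \<noteq> e" "d \<noteq> f" "e \<noteq> f"
      using card(2) by (auto simp: card_3_iff)
    obtain g h i where Z: "Z = {g, h, i}" "g \<noteq> h" "g \<noteq> i" "h \<noteq> i"
      using card(3) by (auto simp: card_3_iff)
    have "distinct [a, b, c, d, e, f, g, h, i]" using X Y Z disj by auto
    then show ?thesis unfolding X(1) Y(1) Z(1) by (rule isomorphic_partial_parallel_classI)
  qed
  show "isomorphic_blocks hut_fragment {X, Y, Z}"
    if disj: "X \<inter> Y = {}" "X \<inter> Z = {}" and meet: "Y \<inter> Z \<noteq> {}"
  proof -
    obtain d where d: "d \<in> Y" "d \<in> Z" using meet by auto
    obtain a b c where X: "X = {a, b, c}" "a \<noteq> b" "a \<noteq> c" "b \<noteq> c"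
      using card(1) by (auto simp: card_3_iff)
    obtain e f where Y: "Y = {d, e, f}" "d \<noteq> e" "d \<noteq> f" "e \<noteq> f"
      using card_3_elem[OF card(2) d(1)] .
    obtain g h where Z: "Z = {d, g, h}" "d \<noteq> g" "d \<noteq> h" "g \<noteq> h"
      using card_3_elem[OF card(3) d(2)] .
    \<comment> \<open>A second common point of \<open>Y\<close> and \<open>Z\<close> would have to
      equal \<open>d\<close>.\<close>
    have "e \<notin> Z" "f \<notin> Z" using YZ[of d e] YZ[of d f] d Y by auto
    then have "distinct [a, b, c, d, e, f, g, h]" using X Y Z disj by auto
    then show ?thesis unfolding X(1) Y(1) Z(1) by (rule isomorphic_hutI)
  qed
  show "isomorphic_blocks star_fragment {X, Y, Z}" if meet: "X \<inter> Y \<inter> Z \<noteq> {}"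
  proof -
    obtain a where a: "a \<in> X" "a \<in> Y" "a \<in> Z" using meet by auto
    obtain b c where X: "X = {a, b, c}" "a \<noteq> b" "a \<noteq> c" "b \<noteq> c"
      using card_3_elem[OF card(1) a(1)] .
    obtain d e where Y: "Y = {a, d, e}" "a \<noteq> d" "a \<noteq> e" "d \<noteq> e"
      using card_3_elem[OF card(2) a(2)] .
    obtain f g where Z: "Z = {a, f, g}" "a \<noteq> f" "a \<noteq> g" "f \<noteq> g"
      using card_3_elem[OF card(3) a(3)] .
    have "b \<notin> Y" "c \<notin> Y" "b \<notin> Z" "c \<notin> Z" "d \<notin> Z" "e \<notin> Z"
      using XY[of a b] XY[of a c] XZ[of a b] XZ[of a c] YZ[of a d] YZ[of a e] a X Y by auto
    then have "distinct [a, b, c, d, e, f, g]" using X Y Z by auto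
    then show ?thesis unfolding X(1) Y(1) Z(1) by (rule isomorphic_starI)
  qed
  show "isomorphic_blocks path_fragment {X, Y, Z}"
    if meet: "X \<inter> Y \<noteq> {}" "X \<inter> Z = {}" "Y \<inter> Z \<noteq> {}"
  proof -
    obtain c where c: "c \<in> X" "c \<in> Y" using meet(1) by auto
    obtain e where e: "e \<in> Y" "e \<in> Z" using meet(3) by auto
    \<comment> \<open>Otherwise the end blocks \<open>X\<close> and \<open>Z\<close> of the path
      would share this point.\<close>
    have "c \<noteq> e" using c e meet(2) by auto
    obtain a b where X: "X = {c, a, b}" "c \<noteq> a" "c \<noteq> b" "a \<noteq> b"
      using card_3_elem[OF card(1) c(1)] .
    obtain d where Y: "Y = {c, e, d}" "c \<noteq> d" "e \<noteq> d"
      using card_3_elem2[OF card(2) c(2) e(1) \<open>c \<noteq> e\<close>] .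
    obtain f g where Z: "Z = {e, f, g}" "e \<noteq> f" "e \<noteq> g" "f \<noteq> g"
      using card_3_elem[OF card(3) e(2)] .
    have "a \<notin> Y" "b \<notin> Y" "c \<notin> Z" "d \<notin> Z"
      using XY[of c a] XY[of c b] YZ[of e d] meet(2) c e X Y by auto
    then have "distinct [a, b, c, d, e, f, g]" using X Y Z \<open>c \<noteq> e\<close> meet(2) by auto
    then have "isomorphic_blocks path_fragment {{a, b, c}, {c, d, e}, {e, f, g}}"
      by (rule isomorphic_pathI)
    then show ?thesis by (simp add: X(1) Y(1) Z(1) insert_commute)
  qed
  show "isomorphic_blocks triangle_fragment {X, Y, Z}"
    if meet: "X \<inter> Y \<noteq> {}" "X \<inter> Z \<noteq> {}" "Y \<inter> Z \<noteq> {}" "X \<inter> Y \<inter> Z = {}"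
  proof -
    obtain a where a: "a \<in> X" "a \<in> Y" using meet(1) by auto
    obtain b where b: "b \<in> X" "b \<in> Z" using meet(2) by auto
    obtain c where c: "c \<in> Y" "c \<in> Z" using meet(3) by auto
    \<comment> \<open>Two equal corners would be a point on all three blocks.\<close>
    have abc: "a \<noteq> b" "a \<noteq> c" "b \<noteq> c" using a b c meet(4) by auto
    obtain f where X: "X = {a, b, f}" "a \<noteq> f" "b \<noteq> f"
      using card_3_elem2[OF card(1) a(1) b(1) abc(1)] .
    obtain e where Y: "Y = {a, c, e}" "a \<noteq> e" "c \<noteq> e"
      using card_3_elem2[OF card(2) a(2) c(1) abc(2)] .
    obtain d where Z: "Z = {b, c, d}" "b \<noteq> d" "c \<noteq> d"
      using card_3_elem2[OF card(3) b(2) c(2) abc(3)] .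
    have "f \<notin> Y" "f \<notin> Z" "e \<notin> Z" "a \<notin> Z" "b \<notin> Y" "c \<notin> X"
      using XY[of a f] XZ[of b f] YZ[of c e] meet(4) a b c X(1-3) Y by auto
    then have "distinct [a, b, c, d, e, f]" using X Y Z abc by auto
    then show ?thesis unfolding X(1) Y(1) Z(1) by (rule isomorphic_triangleI)
  qed
qed

section \<open>Counting in a configuration\<close>

locale linear_blocks =
  fixes B :: "'a set set"
  assumes finite_blocks: "finite B"
    and card_block: "X \<in> B \<Longrightarrow> card X = 3"
    and linear: "X \<in> B \<Longrightarrow> Y \<in> B \<Longrightarrow> X \<noteq> Y \<Longrightarrow> x \<in> X \<inter> Y \<Longrightarrow> y \<in> X \<inter> Y \<Longrightarrow> x = y"
begin

definition triples :: "'a set set set" where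
  "triples = {S. S \<subseteq> B \<and> card S = 3}"

lemma finite_triples: "finite triples"
  unfolding triples_def using finite_blocks by simp

text \<open>Written as a sum of indicators, so that identities valid for each single triple can be
  added up.\<close>

lemma occurrences_eq_sum:
  "occurrences F B = (\<Sum>S\<in>triples. of_bool (isomorphic_blocks F S))"
  unfolding occurrences_def using finite_triples
  by (simp add: triples_def Int_def conj_assoc)

text \<open>Each pair of blocks meets or not, giving eight patterns; after a permutation of the
  blocks each is a case of \<open>linear_triple_fragment\<close>, and three edges split according to
  a common point.\<close>

lemma fragment_cases:
  assumes "S \<in> triples"
  shows "isomorphic_blocks partial_parallel_class_fragment S \<and> meet_count S = 0 \<and> cherry_count S = 0 \<or>
    isomorphic_blocks hut_fragment S \<and> meet_count S = 2 \<and> cherry_count S = 0 \<or>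
    isomorphic_blocks path_fragment S \<and> meet_count S = 4 \<and> cherry_count S = 2 \<or>
    isomorphic_blocks star_fragment S \<and> meet_count S = 6 \<and> cherry_count S = 6 \<and> \<Inter>S \<noteq> {} \<or>
    isomorphic_blocks triangle_fragment S \<and> meet_count S = 6 \<and> cherry_count S = 6 \<and> \<Inter>S = {}"
proof -
  obtain X Y Z where S: "S = {X, Y, Z}" and neq: "X \<noteq> Y" "X \<noteq> Z" "Y \<noteq> Z"
    and in_B: "X \<in> B" "Y \<in> B" "Z \<in> B"
    using assms unfolding triples_def by (auto simp: card_3_iff)
  have fragments:
    "U \<inter> V = {} \<Longrightarrow> U \<inter> W = {} \<Longrightarrow> V \<inter> W = {} \<Longrightarrow>
      isomorphic_blocks partial_parallel_class_fragment {U, V, W}"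
    "U \<inter> V = {} \<Longrightarrow> U \<inter> W = {} \<Longrightarrow> V \<inter> W \<noteq> {} \<Longrightarrow> isomorphic_blocks hut_fragment {U, V, W}"
    "U \<inter> V \<inter> W \<noteq> {} \<Longrightarrow> isomorphic_blocks star_fragment {U, V, W}"
    "U \<inter> V \<noteq> {} \<Longrightarrow> U \<inter> W = {} \<Longrightarrow> V \<inter> W \<noteq> {} \<Longrightarrow> isomorphic_blocks path_fragment {U, V, W}"
    "U \<inter> V \<noteq> {} \<Longrightarrow> U \<inter> W \<noteq> {} \<Longrightarrow> V \<inter> W \<noteq> {} \<Longrightarrow> U \<inter> V \<inter> W = {} \<Longrightarrow>
      isomorphic_blocks triangle_fragment {U, V, W}"
    if "U \<in> B" "V \<in> B" "W \<in> B" "U \<noteq> V" "U \<noteq> W" "V \<noteq> W" for U V W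
    using linear_triple_fragment[OF that(1-3)[THEN card_block] that(4-6)
      linear[OF that(1,2,4)] linear[OF that(1,3,5)] linear[OF that(2,3,6)]] by simp_all
  \<comment> \<open>The hut needs each block once as the isolated one, the path each block once as
    the middle one. The four orders supply these: huts from \<open>XYZ\<close>, \<open>YXZ\<close>,
    \<open>ZXY\<close>, paths from \<open>XYZ\<close>, \<open>YXZ\<close>,
    \<open>XZY\<close>.\<close>
  note XYZ = fragments[OF in_B neq]
  note YXZ = fragments[OF in_B(2,1,3) neq(1)[symmetric] neq(3,2)]
  note ZXY = fragments[OF in_B(3,1,2) neq(2,3)[symmetric] neq(1)]
  note XZY = fragments[OF in_B(1,3,2) neq(2,1) neq(3)[symmetric]]
  have perm: "{Y, X, Z} = S" "{Z, X, Y} = S" "{X, Z, Y} = S" using S by auto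
  have Inter: "\<Inter>S = X \<inter> Y \<inter> Z" using S by auto
  note counts = meet_count_eq[OF neq, folded S] cherry_count_eq[OF neq, folded S]
  note isos = XYZ[folded S] YXZ(2,4)[unfolded perm] ZXY(2)[unfolded perm] XZY(4)[unfolded perm]
  note isos' = isos[unfolded Int_commute[of Y X] Int_commute[of Z X] Int_commute[of Z Y]]
  \<comment> \<open>Discards the contradictory cases with a common point but a disjoint
    pair.\<close>
  have Int_empty: "X \<inter> Y \<inter> Z \<noteq> {} \<Longrightarrow> X \<inter> Y \<noteq> {} \<and> X \<inter> Z \<noteq> {} \<and> Y \<inter> Z \<noteq> {}"
    by blast
  show ?thesis
    using isos' Int_empty unfolding counts Inter
    by (cases "X \<inter> Y = {}"; cases "X \<inter> Z = {}"; cases "Y \<inter> Z = {}"; cases "X \<inter> Y \<inter> Z = {}")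
      simp_all
qed

text \<open>Some type applies by \<open>fragment_cases\<close>, and no two do since their invariants
  differ. So exactly one indicator is 1, and the coefficients are the values of the two counts on
  each type.\<close>

lemma count_identities:
  assumes "S \<in> triples"
  shows "of_bool (isomorphic_blocks partial_parallel_class_fragment S)
      + of_bool (isomorphic_blocks hut_fragment S) + of_bool (isomorphic_blocks path_fragment S)
      + of_bool (isomorphic_blocks star_fragment S)
      + of_bool (isomorphic_blocks triangle_fragment S) = (1 :: nat)"
    and "meet_count S = 2 * of_bool (isomorphic_blocks hut_fragment S)
      + 4 * of_bool (isomorphic_blocks path_fragment S)
      + 6 * of_bool (isomorphic_blocks star_fragment S)
      + 6 * of_bool (isomorphic_blocks triangle_fragment S)"
    and "cherry_count S = 2 * of_bool (isomorphic_blocks path_fragment S)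
      + 6 * of_bool (isomorphic_blocks star_fragment S)
      + 6 * of_bool (isomorphic_blocks triangle_fragment S)"
  using fragment_cases[OF assms] isomorphic_partial_parallel_classD[of S] isomorphic_hutD[of S]
    isomorphic_starD[of S] isomorphic_pathD[of S] isomorphic_triangleD[of S]
  by (auto split: if_splits)

text \<open>Groups the ordered triples of distinct blocks by their underlying set; the fibre over
  \<open>S\<close> is \<open>orderings S\<close>. This turns sums over 3-sets into successive
  choices of blocks.\<close>

lemma sum_orderings:
  "(\<Sum>S\<in>triples. sum q (orderings S)) =
    (\<Sum>X\<in>B. \<Sum>Y\<in>B - {X}. \<Sum>Z\<in>B - {X, Y}. q (X, Y, Z) :: nat)"
proof -
  let ?D = "SIGMA X:B. SIGMA Y:B - {X}. B - {X, Y}"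
  let ?g = "\<lambda>(X, Y, Z). {X, Y, Z}"
  have fin: "finite ?D" using finite_blocks by auto
  have "{X, Y, Z} \<in> triples" if "X \<in> B" "Y \<in> B - {X}" "Z \<in> B - {X, Y}" for X Y Z
  proof -
    have "X \<noteq> Y" "X \<noteq> Z" "Y \<noteq> Z" using that by blast+
    then show ?thesis using that by (simp add: triples_def)
  qed
  then have "?g ` ?D \<subseteq> triples" by fast
  then have "sum q ?D = (\<Sum>S\<in>triples. sum q {t \<in> ?D. ?g t = S})"
    using sum.group[OF fin finite_triples, of ?g q] by simp
  also have "\<dots> = (\<Sum>S\<in>triples. sum q (orderings S))"
    by (intro sum.cong refl arg_cong[where f = "sum q"]) (auto simp: triples_def orderings_def)
  finally show ?thesis
    using finite_blocks by (simp add: sum.Sigma)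
qed

end

section \<open>Counts from regularity\<close>

locale symmetric_config =
  fixes v :: nat and P :: "'a set" and B :: "'a set set"
  assumes config: "symmetric_configuration v P B"
begin

lemma finite_points: "finite P" and card_points: "card P = v" and card_blocks: "card B = v"
  and blocks_subset: "X \<in> B \<Longrightarrow> X \<subseteq> P"
  and card_pencil: "x \<in> P \<Longrightarrow> card {b \<in> B. x \<in> b} = 3"
  using config unfolding symmetric_configuration_def by auto

sublocale linear_blocks B
proof
  show fin: "finite B"
    using config unfolding symmetric_configuration_def by (auto intro: finite_subset)
  show "card X = 3" if "X \<in> B" for X
    using config that unfolding symmetric_configuration_def by blast
  show "x = y" if "X \<in> B" "Y \<in> B" "X \<noteq> Y" and xy: "x \<in> X \<inter> Y" "y \<in> X \<inter> Y" for X Y x y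
  proof (rule ccontr)
    assume "x \<noteq> y"
    \<comment> \<open>Two blocks through two distinct points contradict the bound 1 on blocks
      through a pair.\<close>
    have "card {X, Y} \<le> card {b \<in> B. x \<in> b \<and> y \<in> b}"
      using that fin by (intro card_mono) auto
    moreover have "x \<in> P" "y \<in> P" using blocks_subset that by blast+
    then have "card {b \<in> B. x \<in> b \<and> y \<in> b} \<le> 1"
      using config \<open>x \<noteq> y\<close> unfolding symmetric_configuration_def by blast
    ultimately show False using \<open>X \<noteq> Y\<close> by simp
  qed
qed

definition neighbours :: "'a set \<Rightarrow> 'a set set" where
  "neighbours X = {Y \<in> B - {X}. X \<inter> Y \<noteq> {}}"

lemma neighbours_subset: "neighbours X \<subseteq> B - {X}"
  by (auto simp: neighbours_def)

text \<open>Each of the three points of \<open>X\<close> lies on two further blocks. These three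
  families are disjoint, since a block in two of them would share two points with
  \<open>X\<close>.\<close>

lemma card_neighbours:
  assumes "X \<in> B"
  shows "card (neighbours X) = 6"
proof -
  let ?N = "\<lambda>x. {b \<in> B. x \<in> b} - {X}"
  have "neighbours X = (\<Union>x\<in>X. ?N x)" by (auto simp: neighbours_def)
  moreover have "card (\<Union>x\<in>X. ?N x) = (\<Sum>x\<in>X. card (?N x))"
  proof (rule card_UN_disjoint)
    show "finite X" using card_block[OF assms] by (simp add: card_ge_0_finite)
    show "\<forall>x\<in>X. finite (?N x)" using finite_blocks by simp
    show "\<forall>x\<in>X. \<forall>y\<in>X. x \<noteq> y \<longrightarrow> ?N x \<inter> ?N y = {}"
      using linear[OF assms] by blast
  qed
  moreover have "card (?N x) = 2" if "x \<in> X" for x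
  proof -
    have "x \<in> P" using that blocks_subset[OF assms] by blast
    then show ?thesis using card_pencil[of x] that assms finite_blocks by (simp add: card_Diff_singleton)
  qed
  ultimately show ?thesis using card_block[OF assms] by simp
qed

lemma card_blocks_remove_two:
  assumes "X \<in> B" "Y \<in> B - {X}"
  shows "card (B - {X, Y}) = v - 2"
proof -
  have "X \<noteq> Y" using assms(2) by blast
  then show ?thesis using assms by (simp add: card_Diff_subset card_blocks)
qed

lemma sum_card_orderings: "(\<Sum>S\<in>triples. card (orderings S)) = v * ((v - 1) * (v - 2))"
proof -
  have "(\<Sum>S\<in>triples. card (orderings S)) = (\<Sum>X\<in>B. \<Sum>Y\<in>B - {X}. card (B - {X, Y}))"
    using sum_orderings[of "\<lambda>_. 1"] by simp
  also have "\<dots> = (\<Sum>X\<in>B. \<Sum>Y\<in>B - {X}. v - 2)"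
    by (intro sum.cong refl) (simp add: card_blocks_remove_two)
  finally show ?thesis using finite_blocks by (simp add: card_blocks card_Diff_singleton)
qed

text \<open>Choose \<open>X\<close>, then one of its six neighbours \<open>Y\<close>, then any other
  block as \<open>Z\<close>.\<close>

lemma sum_meet_count: "(\<Sum>S\<in>triples. meet_count S) = v * (6 * (v - 2))"
proof -
  have "(\<Sum>S\<in>triples. meet_count S) =
      (\<Sum>X\<in>B. \<Sum>Y\<in>B - {X}. \<Sum>Z\<in>B - {X, Y}. of_bool (X \<inter> Y \<noteq> {}))"
    unfolding meet_count_def by (simp add: sum_orderings)
  also have "\<dots> = (\<Sum>X\<in>B. \<Sum>Y\<in>B - {X}. if X \<inter> Y \<noteq> {} then v - 2 else 0)"
    by (intro sum.cong refl) (simp add: card_blocks_remove_two)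
  also have "\<dots> = (\<Sum>X\<in>B. \<Sum>Y\<in>neighbours X. v - 2)"
    unfolding neighbours_def using finite_blocks by (intro sum.cong refl sum.inter_filter[symmetric]) simp
  finally show ?thesis by (simp add: card_neighbours card_blocks)
qed

text \<open>Choose the centre \<open>X\<close>, then an ordered pair of distinct neighbours: 6 times
  5 ways.\<close>

lemma sum_cherry_count: "(\<Sum>S\<in>triples. cherry_count S) = 30 * v"
proof -
  have "(\<Sum>S\<in>triples. cherry_count S) =
      (\<Sum>X\<in>B. \<Sum>Y\<in>B - {X}. \<Sum>Z\<in>B - {X, Y}. of_bool (X \<inter> Y \<noteq> {} \<and> X \<inter> Z \<noteq> {}))"
    unfolding cherry_count_def by (simp add: sum_orderings)
  also have "\<dots> = (\<Sum>X\<in>B. \<Sum>Y\<in>B - {X}. if X \<inter> Y \<noteq> {} then card (neighbours X - {Y}) else 0)"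
  proof (intro sum.cong refl)
    fix X Y assume "X \<in> B" "Y \<in> B - {X}"
    have "(B - {X, Y}) \<inter> {Z. X \<inter> Z \<noteq> {}} = neighbours X - {Y}" by (auto simp: neighbours_def)
    then show "(\<Sum>Z\<in>B - {X, Y}. of_bool (X \<inter> Y \<noteq> {} \<and> X \<inter> Z \<noteq> {})) =
        (if X \<inter> Y \<noteq> {} then card (neighbours X - {Y}) else 0)"
      using finite_blocks by auto
  qed
  also have "\<dots> = (\<Sum>X\<in>B. \<Sum>Y\<in>neighbours X. card (neighbours X - {Y}))"
    unfolding neighbours_def using finite_blocks by (intro sum.cong refl sum.inter_filter[symmetric]) simp
  also have "\<dots> = (\<Sum>X\<in>B. \<Sum>Y\<in>neighbours X. 5)"
    by (intro sum.cong refl) (simp add: card_Diff_singleton card_neighbours)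
  finally show ?thesis by (simp add: card_neighbours card_blocks)
qed

section \<open>Stars correspond to points\<close>

text \<open>Sending a point to its three blocks is a bijection from the points onto the
  stars.\<close>

lemma occurrences_star: "occurrences star_fragment B = v"
proof -
  let ?p = "\<lambda>x. {b \<in> B. x \<in> b}"
  have "bij_betw ?p P {S \<in> triples. isomorphic_blocks star_fragment S}"
    unfolding bij_betw_def
  proof (intro conjI inj_onI subset_antisym subsetI)
    fix x y assume xy: "x \<in> P" "y \<in> P" "?p x = ?p y"
    \<comment> \<open>Equal pencils put \<open>x\<close> and \<open>y\<close> on two distinct
      blocks, so linearity identifies them.\<close>
    obtain X Y Z where "?p x = {X, Y, Z}" "X \<noteq> Y"
      using card_pencil[OF xy(1)] by (auto simp: card_3_iff)
    then show "x = y" using linear[of X Y x y] xy(3) by blast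
  next
    fix S assume "S \<in> ?p ` P"
    then obtain x where x: "x \<in> P" "S = ?p x" by blast
    then have S: "S \<in> triples" using card_pencil by (auto simp: triples_def)
    obtain X Y Z where XYZ: "S = {X, Y, Z}" "X \<noteq> Y" "X \<noteq> Z" "Y \<noteq> Z"
      using card_pencil x by (metis card_3_iff)
    have "x \<in> \<Inter>S" using x by blast
    then have "X \<inter> Y \<noteq> {}" "X \<inter> Z \<noteq> {}" "Y \<inter> Z \<noteq> {}" "\<Inter>S \<noteq> {}" using XYZ by auto
    \<comment> \<open>These two values leave only the star among the alternatives of
      \<open>fragment_cases\<close>.\<close>
    then have "meet_count S = 6" "\<Inter>S \<noteq> {}" using XYZ by (simp_all add: meet_count_eq)
    then show "S \<in> {S \<in> triples. isomorphic_blocks star_fragment S}"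
      using fragment_cases[OF S] S by auto
  next
    fix S assume S: "S \<in> {S \<in> triples. isomorphic_blocks star_fragment S}"
    then obtain x where x: "x \<in> \<Inter>S" using isomorphic_starD by blast
    have "S \<subseteq> B" "card S = 3" using S by (auto simp: triples_def)
    then obtain X where "X \<in> S" by fastforce
    then have "x \<in> P" using x blocks_subset[of X] \<open>S \<subseteq> B\<close> by blast
    \<comment> \<open>The three blocks of \<open>S\<close> lie in the pencil of their common point,
      which also has only three blocks.\<close>
    moreover have "S = ?p x"
      using x \<open>S \<subseteq> B\<close> \<open>card S = 3\<close> card_pencil[OF \<open>x \<in> P\<close>] finite_blocks
      by (intro card_subset_eq) auto
    ultimately show "S \<in> ?p ` P" by blast
  qed
  then have "card {S \<in> triples. isomorphic_blocks star_fragment S} = v"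
    using bij_betw_same_card card_points by fastforce
  then show ?thesis by (simp add: occurrences_def triples_def conj_assoc)
qed

section \<open>The linear system and its solution\<close>

text \<open>The three identities of \<open>count_identities\<close>, summed over all triples and
  compared with the global counts. The factor 6 is the number of orderings of a 3-set.\<close>

lemma occurrences_linear_equations:
  fixes p h s q t :: nat
  defines "p \<equiv> occurrences partial_parallel_class_fragment B"
    and "h \<equiv> occurrences hut_fragment B" and "s \<equiv> occurrences star_fragment B"
    and "q \<equiv> occurrences path_fragment B" and "t \<equiv> occurrences triangle_fragment B"
  shows "6 * (p + h + q + s + t) = v * ((v - 1) * (v - 2))"
    and "2 * h + 4 * q + 6 * s + 6 * t = v * (6 * (v - 2))"
    and "2 * q + 6 * s + 6 * t = 30 * v"
proof -
  have "p + h + q + s + t = (\<Sum>S\<in>triples. 1)"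
    unfolding p_def h_def s_def q_def t_def occurrences_eq_sum sum.distrib[symmetric]
    by (intro sum.cong refl count_identities(1))
  moreover have "6 * (\<Sum>S\<in>triples. 1) = (\<Sum>S\<in>triples. card (orderings S))"
    unfolding sum_distrib_left by (intro sum.cong refl) (simp add: card_orderings triples_def)
  ultimately show "6 * (p + h + q + s + t) = v * ((v - 1) * (v - 2))"
    using sum_card_orderings by simp
  have "2 * h + 4 * q + 6 * s + 6 * t = (\<Sum>S\<in>triples. meet_count S)"
    unfolding h_def s_def q_def t_def occurrences_eq_sum sum_distrib_left sum.distrib[symmetric]
    by (intro sum.cong refl count_identities(2)[symmetric])
  then show "2 * h + 4 * q + 6 * s + 6 * t = v * (6 * (v - 2))"
    using sum_meet_count by simp
  have "2 * q + 6 * s + 6 * t = (\<Sum>S\<in>triples. cherry_count S)"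
    unfolding s_def q_def t_def occurrences_eq_sum sum_distrib_left sum.distrib[symmetric]
    by (intro sum.cong refl count_identities(3)[symmetric])
  then show "2 * q + 6 * s + 6 * t = 30 * v"
    using sum_cherry_count by simp
qed

text \<open>Serves to rule out \<open>v = 1\<close>, where truncated subtraction makes
  \<open>v - 2\<close> differ from the real difference: a single block already has six
  neighbours.\<close>

lemma order_cases: "v = 0 \<or> v \<ge> 2"
proof (cases "B = {}")
  case False
  then obtain X where "X \<in> B" by blast
  then have "6 \<le> card B"
    using card_neighbours neighbours_subset[of X] finite_blocks by (metis card_mono Diff_subset subset_trans)
  then show ?thesis using card_blocks by simp
qed (use card_blocks in simp)

end

theorem mainTheorem1:
  fixes P :: "'a set" and B :: "'a set set" and v t b\<^sub>1 b\<^sub>2 b\<^sub>3 b\<^sub>4 b\<^sub>5 :: nat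
  assumes "symmetric_configuration v P B"
    and "connected_configuration P B"
    and "b\<^sub>1 = occurrences partial_parallel_class_fragment B"
    and "b\<^sub>2 = occurrences hut_fragment B"
    and "b\<^sub>3 = occurrences star_fragment B"
    and "b\<^sub>4 = occurrences path_fragment B"
    and "b\<^sub>5 = occurrences triangle_fragment B"
    and "t = b\<^sub>5"
  shows "real b\<^sub>1 = (real v ^ 3 - 21 * real v ^ 2 + 122 * real v - 6 * real t) / 6 \<and>
         real b\<^sub>2 = 3 * (real v * (real v - 11) + real t) \<and>
         b\<^sub>3 = v \<and>
         real b\<^sub>4 = 3 * (4 * real v - real t) \<and>
         b\<^sub>5 = t"
proof -
  interpret symmetric_config v P B using assms(1) by unfold_locales
  have star: "b\<^sub>3 = v" using assms(5) occurrences_star by simp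
  \<comment> \<open>For \<open>v = 0\<close> the factor \<open>v\<close> makes both sides vanish;
    for larger \<open>v\<close> the subtractions are exact.\<close>
  have minus: "real (v * ((v - 1) * (v - 2))) = real v * ((real v - 1) * (real v - 2))"
    "real (v * (6 * (v - 2))) = real v * (6 * (real v - 2))"
    using order_cases by (auto simp: of_nat_diff)
  note eqs = occurrences_linear_equations[folded assms(3-7), THEN arg_cong[where f = real],
      unfolded minus star assms(8)[symmetric]]
  \<comment> \<open>With \<open>v\<close> stars and \<open>t\<close> triangles the system is
    triangular: the cherry equation yields the paths, then the meeting equation the huts, and the
    total the parallel classes.\<close>
  have path: "real b\<^sub>4 = 3 * (4 * real v - real t)"
    using eqs(3) by simp
  have hut: "real b\<^sub>2 = 3 * (real v * (real v - 11) + real t)"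
    using eqs(2) path by (simp add: algebra_simps)
  have "real b\<^sub>1 = (real v ^ 3 - 21 * real v ^ 2 + 122 * real v - 6 * real t) / 6"
    using eqs(1) path hut by (simp add: algebra_simps power2_eq_square power3_eq_cube)
  then show ?thesis using hut star path assms(8) by simp
qed

end
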